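(* Let $H$ be a fixed graph and let $d$ be its degeneracy. Let $g:\mathbb N\to\mathbb R$ be a function tending to infinity (arbitrarily slowly) as $n\to\infty$. Then w.h.p. $\tau(\mathcal P_H,n)\le g(n)\cdot n^{(d-1)/d}$; that is, there is a strategy for Builder in the online semi-random process such that with probability $1-o(1)$ his multigraph after $\lfloor g(n)n^{(d-1)/d}\rfloor$ rounds contains a copy of $H$.
   Context: Semi-random multigraph process (online version): fix $n$ and start with the empty multigraph on $[n]$. In each round $t$, a vertex $v_t$ is chosen uniformly at random from $[n]$, independently of all previous rounds; Builder then chooses $u_t\in[n]$ (possibly $u_t=v_t$), which may depend only on $v_1,\dots,v_t$, his earlier choices and his own randomness, and adds the edge $u_tv_t$ (loops and multiple edges allowed). For a monotone increasing property $\mathcal P$, $\tau_p(\mathcal P,n)$ is the least $m$ such that some strategy produces, after $m$ rounds, a multigraph in $\mathcal P$ with probability at least $p$; "w.h.p. $\tau(\mathcal P,n)\le m$" means $\tau_{1-o(1)}(\mathcal P,n)\le m$. $\mathcal P_H$ is the property of containing $H$ as a subgraph. The degeneracy of $H$ is the least $k$ such that every subgraph of $H$ has a vertex of degree at most $k$. *)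

theory Defs
  imports "HOL-Probability.Probability" "HOL-Library.Multiset" "HOL-Library.Extended_Nat"
    "HOL-Library.Extended_Real"
begin

definition simple_graph :: "'a set \<Rightarrow> 'a set set \<Rightarrow> bool" where
  "simple_graph V E \<longleftrightarrow> finite V \<and> (\<forall>e\<in>E. e \<subseteq> V \<and> card e = 2)"

definition degree :: "'a set set \<Rightarrow> 'a \<Rightarrow> nat" where
  "degree E v = card {e \<in> E. v \<in> e}"

text \<open>Subgraphs are required to have at least one vertex; they need not be induced.\<close>
definition degeneracy :: "'a set \<Rightarrow> 'a set set \<Rightarrow> nat" where
  "degeneracy V E = (LEAST k. \<forall>V' E'. V' \<subseteq> V \<and> E' \<subseteq> E \<and> simple_graph V' E' \<and> V' \<noteq> {} \<longrightarrow>
     (\<exists>v\<in>V'. degree E' v \<le> k))"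

text \<open>A multigraph is a vertex set together with a multiset of edges; the edge joining u and v is
  the set {u, v}, so that loops are singletons.\<close>
type_synonym 'a multigraph = "'a set \<times> 'a set multiset"

text \<open>The property of containing (V, E) as a subgraph. As (V, E) is simple, each of
  its edges only has to occur with multiplicity at least one.\<close>
definition contains_graph :: "'a set \<Rightarrow> 'a set set \<Rightarrow> 'b multigraph set" where
  "contains_graph V E = {(W, M). \<exists>f. inj_on f V \<and> f ` V \<subseteq> W \<and> (\<forall>e\<in>E. f ` e \<in># M)}"

text \<open>A history lists the pairs (u, v) in chronological order, v being the random vertex and u
  Builder's choice. Given the history and the vertex currently offered, a strategy returns the
  conditional distribution of Builder's next choice; this is how his own randomness enters.\<close>
type_synonym history = "(nat \<times> nat) list"
type_synonym strategy = "history \<Rightarrow> nat \<Rightarrow> nat pmf"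

definition valid_strategy :: "nat \<Rightarrow> strategy \<Rightarrow> bool" where
  "valid_strategy n \<sigma> \<longleftrightarrow> (\<forall>h. \<forall>v\<in>{1..n}. set_pmf (\<sigma> h v) \<subseteq> {1..n})"

text \<open>Meaningful only for n > 0, since the uniform distribution on the empty set is unspecified.\<close>
primrec semi_random_process :: "nat \<Rightarrow> strategy \<Rightarrow> nat \<Rightarrow> history pmf" where
  "semi_random_process n \<sigma> 0 = return_pmf []"
| "semi_random_process n \<sigma> (Suc t) =
     bind_pmf (semi_random_process n \<sigma> t) (\<lambda>h.
       bind_pmf (pmf_of_set {1..n}) (\<lambda>v.
         map_pmf (\<lambda>u. h @ [(u, v)]) (\<sigma> h v)))"

definition builder_multigraph :: "nat \<Rightarrow> history \<Rightarrow> nat multigraph" where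
  "builder_multigraph n h = ({1..n}, mset (map (\<lambda>(u, v). {u, v}) h))"

definition success_prob :: "nat multigraph set \<Rightarrow> nat \<Rightarrow> strategy \<Rightarrow> nat \<Rightarrow> real" where
  "success_prob P n \<sigma> m =
     measure_pmf.prob (semi_random_process n \<sigma> m) {h. builder_multigraph n h \<in> P}"

text \<open>The least m for which some strategy succeeds with probability at least p; it is infinite
  if there is no such m.\<close>
definition tau :: "real \<Rightarrow> nat multigraph set \<Rightarrow> nat \<Rightarrow> enat" where
  "tau p P n = Inf {enat m | m. \<exists>\<sigma>. valid_strategy n \<sigma> \<and> success_prob P n \<sigma> m \<ge> p}"

definition whp_tau_le :: "nat multigraph set \<Rightarrow> (nat \<Rightarrow> real) \<Rightarrow> bool" where
  "whp_tau_le P m \<longleftrightarrow> (\<exists>\<epsilon>. \<epsilon> \<longlonglongrightarrow> (0::real) \<and>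
     (\<forall>\<^sub>F n in sequentially. ereal_of_enat (tau (1 - \<epsilon> n) P n) \<le> ereal (m n)))"

end

theory Submission
  imports Defs
begin

text \<open>Embed the vertices of the graph one at a time, in an order in which each vertex has at most
  d neighbours among its predecessors. To embed a vertex whose earlier neighbours already have
  images x(1), ..., x(r), let q be about the d-th root of n and collect pools of unused vertices:
  pool j consists of about q^(d - j) vertices adjacent to all of x(1), ..., x(j). A vertex of pool
  j that is offered by the process is joined to x(j + 1) and thereby enters pool j + 1. A new
  element arrives with probability at least about q^(d - j) / (2 n), so pool j + 1 is complete
  after an expected number of at most 2 n / q rounds. The expected total time is therefore
  O(n / q), that is O(n^((d - 1) / d)), and the claim follows by Markov's inequality.\<close>

section \<open>The value function of an optimal Builder and waiting times\<close>

text \<open>The expected value of min(T, m), where T is the time at which an optimal Builder, starting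
  from the edge set F, reaches P. As all estimates are upper bounds for this value, strategies can
  be composed without ever being written down.\<close>
primrec opt_time :: "nat \<Rightarrow> (nat set set \<Rightarrow> bool) \<Rightarrow> nat \<Rightarrow> nat set set \<Rightarrow> real" where
  "opt_time n P 0 F = 0"
| "opt_time n P (Suc m) F = (if P F then 0
     else 1 + (\<Sum>v=1..n. MIN u\<in>{1..n}. opt_time n P m (insert {u, v} F)) / real n)"

text \<open>The bound is uniform in the horizon \<open>m\<close>, so that estimates can be chained
  without tracking how many rounds remain.\<close>

definition opt_time_le :: "nat \<Rightarrow> (nat set set \<Rightarrow> bool) \<Rightarrow> nat set set \<Rightarrow> real \<Rightarrow> bool" where
  "opt_time_le n P F c \<longleftrightarrow> (\<forall>m. opt_time n P m F \<le> c)"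

lemma opt_time_nonneg:
  assumes "n > 0"
  shows "opt_time n P m F \<ge> 0"
proof (induction m arbitrary: F)
  case (Suc m)
  have "(MIN u\<in>{1..n}. opt_time n P m (insert {u, v} F)) \<ge> 0" for v
    using assms Suc by (subst Min_ge_iff) auto
  then show ?case
    by (auto intro!: add_nonneg_nonneg divide_nonneg_nonneg sum_nonneg)
qed simp

lemma opt_time_eq_0: "P F \<Longrightarrow> opt_time n P m F = 0"
  by (cases m) auto

lemma Min_image_mono:
  fixes f g :: "'a \<Rightarrow> 'b::linorder"
  assumes "finite A" "A \<noteq> {}" "\<And>x. x \<in> A \<Longrightarrow> f x \<le> g x"
  shows "Min (f ` A) \<le> Min (g ` A)"
  using assms by (subst Min_ge_iff) (auto intro: Min_le_iff[THEN iffD2])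

text \<open>Builder can copy from \<open>F'\<close> any play from \<open>F\<close>; since
  \<open>P\<close> is monotone, the copy stops no later. Hence edges added in useless rounds do no
  harm.\<close>

lemma opt_time_antimono:
  assumes "n > 0" "mono P" "F \<subseteq> F'"
  shows "opt_time n P m F' \<le> opt_time n P m F"
  using assms(3)
proof (induction m arbitrary: F F')
  case (Suc m)
  show ?case
  proof (cases "P F'")
    case True
    then show ?thesis
      using opt_time_nonneg[OF assms(1)] by (simp del: opt_time.simps add: opt_time_eq_0)
  next
    case False
    with assms(2) Suc.prems have "\<not> P F"
      by (auto dest: monoD)
    moreover have "(MIN u\<in>{1..n}. opt_time n P m (insert {u, v} F'))
        \<le> (MIN u\<in>{1..n}. opt_time n P m (insert {u, v} F))" for v
      using assms(1) Suc.prems by (intro Min_image_mono Suc.IH) auto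
    ultimately show ?thesis
      using False by (auto intro!: divide_right_mono sum_mono)
  qed
qed simp

lemma opt_time_le_finished: "P F \<Longrightarrow> c \<ge> 0 \<Longrightarrow> opt_time_le n P F c"
  by (simp add: opt_time_le_def opt_time_eq_0)

lemma opt_time_le_mono: "opt_time_le n P F c \<Longrightarrow> c \<le> c' \<Longrightarrow> opt_time_le n P F c'"
  unfolding opt_time_le_def by (meson order_trans)

text \<open>If every offer of a vertex of G leads to a state of value at most c, then the state before
  it costs the expected waiting time n / |G| more.\<close>
lemma opt_time_le_wait:
  assumes "mono P" "G \<subseteq> {1..n}" "G \<noteq> {}"
    and step: "\<And>v. v \<in> G \<Longrightarrow> \<exists>u\<in>{1..n}. opt_time_le n P (insert {u, v} F) c"
  shows "opt_time_le n P F (c + real n / real (card G))"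
proof -
  have fin: "finite G"
    using assms(2) finite_subset by blast
  then have G: "card G > 0" "card G \<le> n"
    using assms(3) card_mono[OF _ assms(2)] by (auto simp: card_gt_0_iff)
  then have n: "n > 0"
    by simp
  obtain v0 where "v0 \<in> G"
    using assms(3) by blast
  with step obtain u where "opt_time_le n P (insert {u, v0} F) c"
    by blast
  then have c: "c \<ge> 0"
    unfolding opt_time_le_def by (metis opt_time.simps(1))
  \<comment> \<open>This is the solution of C = 1 + (|G| c + (n - |G|) C) / n, the recursion in
    which an offer outside \<open>G\<close> leaves the bound unchanged. It is thus preserved by
    induction on the horizon.\<close>
  define C where "C = c + real n / real (card G)"
  have C: "C \<ge> 0"
    using c by (simp add: C_def)
  have "opt_time n P m F \<le> C" for m
  proof (induction m)
    case 0
    then show ?case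
      using C by simp
  next
    case (Suc m)
    let ?M = "\<lambda>v. MIN u\<in>{1..n}. opt_time n P m (insert {u, v} F)"
    have M: "?M v \<le> opt_time n P m (insert {u, v} F)" if "u \<in> {1..n}" for u v
      using that by (intro Min_le) auto
    have "?M v \<le> c" if "v \<in> G" for v
      using step[OF that] M unfolding opt_time_le_def by (meson order_trans)
    then have "sum ?M G \<le> real (card G) * c"
      by (intro sum_bounded_above) auto
    moreover have "?M v \<le> C" for v
    proof -
      \<comment> \<open>For an offer outside \<open>G\<close> any reply will do; vertex 1 is an
        arbitrary choice.\<close>
      have "?M v \<le> opt_time n P m (insert {1, v} F)"
        using n by (intro M) auto
      also have "\<dots> \<le> opt_time n P m F"
        using n assms(1) by (intro opt_time_antimono) auto
      finally show ?thesis
        using Suc by simp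
    qed
    then have "sum ?M ({1..n} - G) \<le> real (card ({1..n} - G)) * C"
      by (intro sum_bounded_above) auto
    ultimately have "sum ?M {1..n} \<le> real (card G) * c + (real n - real (card G)) * C"
      using sum.subset_diff[OF assms(2), of ?M] fin G(2) assms(2)
      by (simp add: card_Diff_subset of_nat_diff)
    also have "\<dots> = real n * (C - 1)"
      using G by (simp add: C_def field_simps)
    finally have "sum ?M {1..n} / real n \<le> C - 1"
      using n by (simp add: field_simps)
    then show ?case
      using C by simp
  qed
  then show ?thesis
    by (simp add: opt_time_le_def C_def)
qed

section \<open>From expected time to success probability\<close>

text \<open>Builder always minimises the value of the next state. The potential \<open>pot\<close>,
  which starts at \<open>opt_time n P m {}\<close>, then never increases in expectation, and
  Markov's inequality at time \<open>m\<close> bounds the probability of failure.\<close>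

lemma success_prob_opt_time:
  assumes "n > 0" "m > 0" "mono P"
    and P: "\<And>h. builder_multigraph n h \<in> Q \<longleftrightarrow> P ((\<lambda>(u, v). {u, v}) ` set h)"
  obtains \<sigma> where "valid_strategy n \<sigma>"
    "success_prob Q n \<sigma> m \<ge> 1 - opt_time n P m {} / real m"
proof -
  define edges :: "history \<Rightarrow> nat set set" where "edges h = (\<lambda>(u, v). {u, v}) ` set h" for h
  \<comment> \<open>The length of the history serves as the clock: \<open>m - Suc (length h)\<close>
    rounds remain after the current one.\<close>
  define best where "best h v =
    arg_min_on (\<lambda>u. opt_time n P (m - Suc (length h)) (insert {u, v} (edges h))) {1..n}" for h v
  define \<sigma> :: strategy where "\<sigma> = (\<lambda>h v. return_pmf (best h v))"
  have best: "best h v \<in> {1..n}"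
    "opt_time n P (m - Suc (length h)) (insert {best h v, v} (edges h)) =
      (MIN u\<in>{1..n}. opt_time n P (m - Suc (length h)) (insert {u, v} (edges h)))" for h v
  proof -
    let ?f = "\<lambda>u. opt_time n P (m - Suc (length h)) (insert {u, v} (edges h))"
    have ne: "finite {1..n}" "{1..n} \<noteq> {}"
      using assms(1) by auto
    show *: "best h v \<in> {1..n}"
      unfolding best_def by (rule arg_min_if_finite(1)[OF ne])
    have "?f (best h v) \<le> ?f u" if "u \<in> {1..n}" for u
      unfolding best_def using arg_min_least[OF ne that, of ?f] by simp
    with * show "?f (best h v) = Min (?f ` {1..n})"
      by (intro Min_eqI[symmetric]) auto
  qed
  have valid: "valid_strategy n \<sigma>"
    using best(1) by (auto simp: valid_strategy_def \<sigma>_def)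
  let ?proc = "semi_random_process n \<sigma>"
  define next_pmf where "next_pmf = (\<lambda>h. map_pmf (\<lambda>v. h @ [(best h v, v)]) (pmf_of_set {1..n}))"
  have proc_Suc: "?proc (Suc t) = bind_pmf (?proc t) next_pmf" for t
    by (simp add: \<sigma>_def next_pmf_def map_pmf_def bind_return_pmf)
  have fin_next: "finite (set_pmf (next_pmf h))" for h
    using assms(1) by (simp add: next_pmf_def)
  have fin: "finite (set_pmf (?proc t))" for t
    by (induction t) (use fin_next in \<open>auto simp: proc_Suc simp del: semi_random_process.simps(2)\<close>)
  have len: "length h = t" if "h \<in> set_pmf (?proc t)" for h t
    using that by (induction t arbitrary: h) auto
  \<comment> \<open>Expected remaining time plus the rounds already spent. The latter are dropped on
    reaching \<open>P\<close>, which only lowers the potential and makes it vanish on all successful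
    histories.\<close>
  define pot where "pot t h =
    opt_time n P (m - t) (edges h) + (if P (edges h) then 0 else real t)" for t h
  have step: "measure_pmf.expectation (next_pmf h) (pot (Suc t)) \<le> pot t h"
    if "length h = t" "t < m" for h t
  proof -
    have edges_app: "edges (h @ [(u, v)]) = insert {u, v} (edges h)" for u v
      by (simp add: edges_def)
    have exp: "measure_pmf.expectation (next_pmf h) (pot (Suc t)) =
        (\<Sum>v=1..n. pot (Suc t) (h @ [(best h v, v)])) / real n"
      using assms(1) by (simp add: next_pmf_def integral_pmf_of_set)
    show ?thesis
    proof (cases "P (edges h)")
      case True
      then have "P (insert e (edges h))" for e
        using assms(3) by (auto dest!: monoD[of P "edges h" "insert e (edges h)"])
      then have "pot (Suc t) (h @ [(u, v)]) = 0" for u v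
        by (simp add: pot_def edges_app opt_time_eq_0)
      with True show ?thesis
        by (simp add: exp pot_def opt_time_eq_0)
    next
      case False
      let ?M = "\<lambda>v. MIN u\<in>{1..n}. opt_time n P (m - Suc t) (insert {u, v} (edges h))"
      have "pot (Suc t) (h @ [(best h v, v)]) \<le> ?M v + real (Suc t)" for v
        using best(2)[of h v] that(1) by (simp add: pot_def edges_app)
      then have "(\<Sum>v=1..n. pot (Suc t) (h @ [(best h v, v)])) / real n
          \<le> (\<Sum>v=1..n. ?M v + real (Suc t)) / real n"
        by (intro divide_right_mono sum_mono) auto
      also have "\<dots> = (\<Sum>v=1..n. ?M v) / real n + real (Suc t)"
        using assms(1) by (simp add: sum.distrib add_divide_distrib)
      \<comment> \<open>As \<open>m - t = Suc (m - Suc t)\<close>, the recursion for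
        \<open>opt_time\<close> applies, and its summand 1 accounts for the passage from
        \<open>t\<close> to \<open>Suc t\<close>.\<close>
      also have "\<dots> = pot t h"
        using that(2) False by (simp add: pot_def Suc_diff_Suc[symmetric])
      finally show ?thesis
        by (simp add: exp)
    qed
  qed
  have pot_le: "measure_pmf.expectation (?proc t) (pot t) \<le> opt_time n P m {}" if "t \<le> m" for t
    using that
  proof (induction t)
    case 0
    then show ?case
      by (simp add: pot_def edges_def)
  next
    case (Suc t)
    have "measure_pmf.expectation (?proc (Suc t)) (pot (Suc t)) =
        (\<Sum>h\<in>set_pmf (?proc t). pmf (?proc t) h *\<^sub>R
          measure_pmf.expectation (next_pmf h) (pot (Suc t)))"
      unfolding proc_Suc by (intro pmf_expectation_bind fin fin_next) auto
    also have "\<dots> \<le> (\<Sum>h\<in>set_pmf (?proc t). pot t h * pmf (?proc t) h)"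
    proof (intro sum_mono)
      fix h assume "h \<in> set_pmf (?proc t)"
      then have "measure_pmf.expectation (next_pmf h) (pot (Suc t)) \<le> pot t h"
        using Suc.prems by (intro step len) auto
      then show "pmf (?proc t) h *\<^sub>R measure_pmf.expectation (next_pmf h) (pot (Suc t))
          \<le> pot t h * pmf (?proc t) h"
        by (simp add: mult.commute[of "pot t h"] mult_left_mono)
    qed
    also have "\<dots> = measure_pmf.expectation (?proc t) (pot t)"
      by (intro integral_measure_pmf_real[symmetric] fin) auto
    finally show ?case
      using Suc by simp
  qed
  let ?S = "{h. builder_multigraph n h \<in> Q}"
  \<comment> \<open>At time \<open>m\<close> no rounds remain, so the potential is \<open>m\<close>
    on failure and 0 on success; its expectation is exactly \<open>m\<close> times the failure
    probability.\<close>
  have "pot m = (\<lambda>h. real m * indicator (- ?S) h)"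
    by (rule ext) (auto simp: pot_def P edges_def indicator_def)
  then have "measure_pmf.expectation (?proc m) (pot m) = real m * measure_pmf.prob (?proc m) (- ?S)"
    by simp
  also have "measure_pmf.prob (?proc m) (- ?S) = 1 - success_prob Q n \<sigma> m"
    using measure_pmf.prob_compl[of ?S "?proc m"] by (simp add: success_prob_def Compl_eq_Diff_UNIV)
  finally have "real m * (1 - success_prob Q n \<sigma> m) \<le> opt_time n P m {}"
    using pot_le[of m] by simp
  then have "1 - success_prob Q n \<sigma> m \<le> opt_time n P m {} / real m"
    using assms(2) by (simp add: field_simps)
  then show thesis
    using that[OF valid] by simp
qed

section \<open>Embedding one further vertex by nested pools\<close>

definition embeds :: "nat \<Rightarrow> 'a set set \<Rightarrow> nat set set \<Rightarrow> 'a set \<Rightarrow> ('a \<Rightarrow> nat) \<Rightarrow> bool" where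
  "embeds n E F U f \<longleftrightarrow> inj_on f U \<and> f ` U \<subseteq> {1..n} \<and> (\<forall>e\<in>E. e \<subseteq> U \<longrightarrow> f ` e \<in> F)"

lemma embeds_mono: "embeds n E F U f \<Longrightarrow> F \<subseteq> F' \<Longrightarrow> embeds n E F' U f"
  by (auto simp: embeds_def)

definition joined :: "nat set set \<Rightarrow> nat set \<Rightarrow> nat set \<Rightarrow> bool" where
  "joined F X S \<longleftrightarrow> (\<forall>x\<in>X. \<forall>w\<in>S. {x, w} \<in> F)"

lemma joined_mono: "joined F X S \<Longrightarrow> F \<subseteq> F' \<Longrightarrow> joined F' X S"
  by (auto simp: joined_def)

text \<open>This and the following lemmas are in continuation-passing style: they bound the time from F
  given a bound c on the remaining time from every state in which the subgoal is achieved.\<close>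
lemma opt_time_le_collect:
  assumes "mono P" "q \<ge> 2" "x \<in> {1..n}" "S \<subseteq> {1..n}" "card S \<ge> q ^ Suc a"
    and goal: "\<And>F' T. F \<subseteq> F' \<Longrightarrow> T \<subseteq> S \<Longrightarrow> card T = q ^ a \<Longrightarrow> joined F' {x} T \<Longrightarrow> opt_time_le n P F' c"
  shows "opt_time_le n P F (c + 2 * real n / real q)"
proof -
  have fin: "finite S"
    using assms(4) finite_subset by blast
  \<comment> \<open>A bound on the waiting time for one new element of the pool;
    \<open>q ^ a\<close> elements at this price cost 2 n / q in total.\<close>
  define w where "w = 2 * real n / real (q ^ Suc a)"
  \<comment> \<open>Induction on the number \<open>i\<close> of vertices still missing from the new
    pool \<open>T\<close>.\<close>
  have *: "opt_time_le n P F' (c + real i * w)"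
    if "F \<subseteq> F'" "T \<subseteq> S" "card T + i = q ^ a" "joined F' {x} T" for F' T i
    using that
  proof (induction i arbitrary: F' T)
    case 0
    then show ?case
      using goal by simp
  next
    case (Suc i)
    have finT: "finite T"
      using Suc.prems(2) fin finite_subset by blast
    \<comment> \<open>Here \<open>q \<ge> 2\<close> is essential: an unfinished \<open>T\<close> has
      fewer than \<open>q ^ a\<close> elements, so at least \<open>q ^ Suc a / 2\<close> vertices of
      \<open>S\<close> are still useful offers.\<close>
    have "2 * q ^ a \<le> q * q ^ a"
      using assms(2) by (intro mult_right_mono) auto
    then have card_ge: "2 * card (S - T) \<ge> q ^ Suc a"
      using Suc.prems(3) assms(5) card_Diff_subset[OF finT Suc.prems(2)]
      unfolding power_Suc by linarith
    moreover have "q ^ Suc a > 0"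
      using assms(2) by simp
    ultimately have pos: "card (S - T) > 0"
      by linarith
    have "opt_time_le n P F' (c + real i * w + real n / real (card (S - T)))"
    proof (rule opt_time_le_wait[OF assms(1)])
      show "S - T \<subseteq> {1..n}"
        using assms(4) by blast
      show "S - T \<noteq> {}"
        using pos by (metis card.empty less_irrefl)
      fix v assume v: "v \<in> S - T"
      have "opt_time_le n P (insert {x, v} F') (c + real i * w)"
        using Suc.prems v finT by (intro Suc.IH[where T = "insert v T"]) (auto simp: joined_def)
      with assms(3) show "\<exists>u\<in>{1..n}. opt_time_le n P (insert {u, v} F') (c + real i * w)"
        by blast
    qed
    moreover have "real n / real (card (S - T)) \<le> w"
    proof -
      have "real n / real (card (S - T)) = 2 * real n / real (2 * card (S - T))"
        by simp
      also have "\<dots> \<le> w"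
        unfolding w_def using card_ge pos assms(2)
        by (intro divide_left_mono) (auto simp del: power_Suc of_nat_mult of_nat_power)
      finally show ?thesis .
    qed
    ultimately show ?case
      by (elim opt_time_le_mono) (simp add: algebra_simps)
  qed
  have "opt_time_le n P F (c + real (q ^ a) * w)"
    by (rule *[of _ "{}"]) (auto simp: joined_def)
  then show ?thesis
    using assms(2) by (simp add: w_def)
qed

text \<open>The vertices of \<open>X\<close> are treated one after another, each costing 2 n / q
  rounds and shrinking the pool by a factor \<open>q\<close>. Since \<open>card X \<le> d\<close>, a
  pool that starts with \<open>q ^ d\<close> vertices is still nonempty at the end.\<close>

lemma opt_time_le_join:
  assumes "mono P" "q \<ge> 2" "finite X" "X \<subseteq> {1..n}" "card X \<le> d" "S \<subseteq> {1..n}" "card S \<ge> q ^ d"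
    and goal: "\<And>F' w. F \<subseteq> F' \<Longrightarrow> w \<in> S \<Longrightarrow> joined F' X {w} \<Longrightarrow> opt_time_le n P F' c"
  shows "opt_time_le n P F (c + real (card X) * (2 * real n / real q))"
proof -
  \<comment> \<open>For the induction the goal is a whole pool \<open>T\<close>, not a single
    vertex, and \<open>c\<close> is arbitrary because the induction hypothesis is used with a larger
    bound.\<close>
  have *: "opt_time_le n P F (c + real (card X) * (2 * real n / real q))"
    if "\<And>F' T. F \<subseteq> F' \<Longrightarrow> T \<subseteq> S \<Longrightarrow> card T \<ge> q ^ (d - card X) \<Longrightarrow> joined F' X T \<Longrightarrow> opt_time_le n P F' c"
    for c
    using assms(3-5) that
  proof (induction X arbitrary: c rule: finite_induct)
    case empty
    then show ?case
      using empty.prems(3)[of F S] assms(7) by (simp add: joined_def)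
  next
    case (insert x X)
    have d: "d - card X = Suc (d - card (insert x X))"
      using insert.hyps insert.prems by simp
    \<comment> \<open>The pool for \<open>X\<close> is built first; the collection of neighbours of
      \<open>x\<close> from that pool belongs to the continuation, whose bound grows by 2 n /
      q.\<close>
    have "opt_time_le n P F (c + 2 * real n / real q + real (card X) * (2 * real n / real q))"
    proof (rule insert.IH)
      fix F' T assume T: "F \<subseteq> F'" "T \<subseteq> S" "card T \<ge> q ^ (d - card X)" "joined F' X T"
      show "opt_time_le n P F' (c + 2 * real n / real q)"
      proof (rule opt_time_le_collect[OF assms(1,2)])
        show "x \<in> {1..n}" "T \<subseteq> {1..n}" "card T \<ge> q ^ Suc (d - card (insert x X))"
          using insert.prems T assms(6) d by auto
        fix F'' T' assume T': "F' \<subseteq> F''" "T' \<subseteq> T" "card T' = q ^ (d - card (insert x X))"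
          "joined F'' {x} T'"
        have "joined F'' (insert x X) T'"
          using T'(2,4) joined_mono[OF T(4) T'(1)] unfolding joined_def by blast
        then show "opt_time_le n P F'' c"
          using T(1,2) T'(1-3) by (intro insert.prems(3)[of F'' T']) auto
      qed
    qed (use insert in auto)
    then show ?case
      using insert.hyps by (simp add: algebra_simps add_divide_distrib)
  qed
  show ?thesis
  proof (rule *)
    fix F' T assume T: "F \<subseteq> F'" "T \<subseteq> S" "card T \<ge> q ^ (d - card X)" "joined F' X T"
    have "q ^ (d - card X) > 0"
      using assms(2) by simp
    with T(3) have "T \<noteq> {}"
      by auto
    then obtain w where "w \<in> T"
      by blast
    with T goal[of F' w] show "opt_time_le n P F' c"
      by (auto simp: joined_def)
  qed
qed

lemma simple_graph_edgeD:
  assumes "simple_graph V E" "e \<in> E" "v \<in> e"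
  obtains x where "e = {x, v}" "x \<noteq> v" "x \<in> V"
proof -
  obtain a b where "e = {a, b}" "a \<noteq> b" "e \<subseteq> V"
    using assms by (auto simp: simple_graph_def card_2_iff)
  with assms(3) that show thesis
    by (cases "v = a") (auto simp: insert_commute)
qed

lemma opt_time_le_extend:
  assumes "mono P" "simple_graph V E" "q \<ge> 2" "U \<subseteq> V" "v \<in> U" "q ^ d + card V \<le> n"
    and deg: "degree {e \<in> E. e \<subseteq> U} v \<le> d"
    and f: "embeds n E F (U - {v}) f"
    and goal: "\<And>F' f'. embeds n E F' U f' \<Longrightarrow> opt_time_le n P F' c"
  shows "opt_time_le n P F (c + real d * (2 * real n / real q))"
proof -
  have fin: "finite V" "finite U"
    using assms(2,4) finite_subset by (auto simp: simple_graph_def)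
  define N where "N = {x \<in> U - {v}. {x, v} \<in> E}"
  have finN: "finite N"
    using fin by (simp add: N_def)
  have finE: "finite E"
    using fin(1) assms(2) by (intro finite_subset[of E "Pow V"]) (auto simp: simple_graph_def)
  \<comment> \<open>Distinct neighbours give distinct edges at \<open>v\<close> inside
    \<open>U\<close>, so their number is at most the degree.\<close>
  have "card N = card ((\<lambda>x. {x, v}) ` N)"
    by (intro card_image[symmetric] inj_onI) (auto simp: doubleton_eq_iff)
  also have "\<dots> \<le> degree {e \<in> E. e \<subseteq> U} v"
    unfolding degree_def using finE assms(5) by (intro card_mono) (auto simp: N_def)
  finally have "card N \<le> d"
    using deg by simp
  then have X: "card (f ` N) \<le> d"
    using card_image_le[OF finN, of f] by simp
  define S where "S = {1..n} - f ` (U - {v})"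
  have "card (f ` (U - {v})) \<le> card V"
    using card_image_le[of "U - {v}" f] card_mono[of V "U - {v}"] fin assms(4) by fastforce
  moreover have "card S \<ge> card {1..n} - card (f ` (U - {v}))"
    unfolding S_def using fin by (intro diff_card_le_card_Diff) auto
  ultimately have S: "card S \<ge> q ^ d"
    using assms(6) by simp
  have "opt_time_le n P F (c + real (card (f ` N)) * (2 * real n / real q))"
  proof (rule opt_time_le_join[OF assms(1,3) _ _ X _ S])
    show "finite (f ` N)" "f ` N \<subseteq> {1..n}" "S \<subseteq> {1..n}"
      using finN f by (auto simp: embeds_def N_def S_def)
    fix F' w assume F': "F \<subseteq> F'" "w \<in> S" "joined F' (f ` N) {w}"
    let ?f = "f(v := w)"
    have "?f ` e \<in> F'" if e: "e \<in> E" "e \<subseteq> U" for e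
    proof (cases "v \<in> e")
      case True
      then obtain x where x: "e = {x, v}" "x \<noteq> v"
        using simple_graph_edgeD[OF assms(2) e(1)] by metis
      with e have "x \<in> N"
        by (auto simp: N_def)
      with x F'(3) show ?thesis
        by (auto simp: joined_def insert_commute)
    next
      case False
      then have "?f ` e = f ` e"
        by (intro image_cong) auto
      moreover have "f ` e \<in> F"
        using f e False by (auto simp: embeds_def)
      ultimately show ?thesis
        using F'(1) by auto
    qed
    moreover have "inj_on ?f U"
      using f F'(2) by (auto simp: embeds_def S_def inj_on_def)
    moreover have "?f ` U \<subseteq> {1..n}"
      using f F'(2) by (auto simp: embeds_def S_def)
    ultimately show "opt_time_le n P F' c"
      by (intro goal[of F' ?f]) (simp only: embeds_def, blast)
  qed
  then show ?thesis
    using X by (elim opt_time_le_mono) (auto intro!: add_left_mono mult_right_mono divide_right_mono)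
qed

section \<open>Embedding the whole graph along a degeneracy order\<close>

text \<open>The minimum defining the degeneracy is attained, because \<open>card E\<close> bounds
  every degree; its property is then applied to the subgraph induced on \<open>U\<close>.\<close>

lemma degeneracy_obtain:
  assumes "simple_graph V E" "U \<subseteq> V" "U \<noteq> {}"
  obtains v where "v \<in> U" "degree {e \<in> E. e \<subseteq> U} v \<le> degeneracy V E"
proof -
  let ?Q = "\<lambda>k. \<forall>V' E'. V' \<subseteq> V \<and> E' \<subseteq> E \<and> simple_graph V' E' \<and> V' \<noteq> {} \<longrightarrow> (\<exists>v\<in>V'. degree E' v \<le> k)"
  have "finite V"
    using assms(1) by (simp add: simple_graph_def)
  then have finE: "finite E"
    using assms(1) by (intro finite_subset[of E "Pow V"]) (auto simp: simple_graph_def)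
  have "degree E' v \<le> card E" if "E' \<subseteq> E" for E' v
    unfolding degree_def using that finE by (intro card_mono) auto
  then have "?Q (card E)"
    by blast
  then have Q: "?Q (degeneracy V E)"
    unfolding degeneracy_def by (rule LeastI)
  have "simple_graph U {e \<in> E. e \<subseteq> U}"
    using assms(1) finite_subset[OF assms(2) \<open>finite V\<close>] by (auto simp: simple_graph_def)
  then have "\<exists>v\<in>U. degree {e \<in> E. e \<subseteq> U} v \<le> degeneracy V E"
    using assms(2,3) by (intro Q[rule_format]) simp
  then show thesis
    using that by blast
qed

text \<open>Induction on \<open>card U\<close> builds the order backwards: a vertex of degree at
  most \<open>d\<close> in the graph induced on \<open>U\<close> is embedded last, and its cost is
  moved into the continuation bound for \<open>U - {v}\<close>.\<close>

lemma opt_time_le_embed: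
  assumes "mono P" "simple_graph V E" "q \<ge> 2" "d = degeneracy V E" "q ^ d + card V \<le> n" "U \<subseteq> V"
    and "\<And>F f. embeds n E F U f \<Longrightarrow> opt_time_le n P F c"
  shows "opt_time_le n P {} (c + real (card U) * (real d * (2 * real n / real q)))"
proof -
  have "finite U"
    using assms(2,6) finite_subset by (auto simp: simple_graph_def)
  then show ?thesis
    using assms(6,7)
  proof (induction "card U" arbitrary: U c)
    case 0
    \<comment> \<open>With no vertices embedded, the empty set is the only possible edge inside
      \<open>U\<close>; excluding it makes the empty embedding valid.\<close>
    moreover have "{} \<notin> E"
      using assms(2) by (auto simp: simple_graph_def)
    ultimately show ?case
      by (auto simp: embeds_def)
  next
    case (Suc k)
    have "U \<noteq> {}"
      using Suc.hyps(2) by auto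
    then obtain v where v: "v \<in> U" "degree {e \<in> E. e \<subseteq> U} v \<le> d"
      unfolding assms(4) by (rule degeneracy_obtain[OF assms(2) Suc.prems(2)])
    have k: "k = card (U - {v})"
      using Suc.hyps(2) Suc.prems(1) v(1) by simp
    have "opt_time_le n P {} (c + real d * (2 * real n / real q)
        + real (card (U - {v})) * (real d * (2 * real n / real q)))"
    proof (rule Suc.hyps(1)[OF k])
      fix F f assume "embeds n E F (U - {v}) f"
      then show "opt_time_le n P F (c + real d * (2 * real n / real q))"
        by (rule opt_time_le_extend[OF assms(1-3) Suc.prems(2) v(1) assms(5) v(2) _ Suc.prems(3)])
    next
      show "finite (U - {v})" "U - {v} \<subseteq> V"
        using Suc.prems(1,2) by auto
    qed
    then show ?case
      using k Suc.hyps(2)[symmetric] by (simp add: algebra_simps add_divide_distrib)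
  qed
qed

section \<open>Choice of q and the order of magnitude\<close>

lemma opt_time_contains_graph:
  assumes "simple_graph V E" "d = degeneracy V E"
  defines "P \<equiv> \<lambda>n F. \<exists>f. embeds n E F V f"
  obtains C where "C \<ge> 0"
    "\<forall>\<^sub>F n in sequentially. \<forall>m. opt_time n (P n) m {} \<le> C * real n powr ((real d - 1) / real d)"
proof -
  have mono: "mono (P n)" for n
    unfolding P_def by (intro monoI le_boolI) (use embeds_mono in blast)
  have fin: "\<And>F f. embeds n E F V f \<Longrightarrow> opt_time_le n (P n) F 0" for n
    by (rule opt_time_le_finished) (auto simp: P_def)
  \<comment> \<open>The 8 is a product of three factors 2: one from the cost 2 n / q, one from
    rounding \<open>y\<close> down to \<open>q\<close>, and one from the halving of \<open>n\<close>
    in \<open>y\<close>.\<close>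
  define C where "C = real (card V) * (real d * 8)"
  have "\<forall>m. opt_time n (P n) m {} \<le> C * real n powr ((real d - 1) / real d)"
    \<comment> \<open>The term \<open>2 * 2 ^ d\<close> ensures \<open>y \<ge> 2\<close>; the term
      \<open>2 * card V\<close> leaves room for \<open>card V\<close> vertices beside
      \<open>q ^ d \<le> n / 2\<close>.\<close>
    if n: "n \<ge> 2 * card V + 2 + 2 * 2 ^ d" for n
  proof (cases "d = 0")
    \<comment> \<open>The cost has the factor \<open>d = 0\<close>, so any admissible
      \<open>q\<close> works; 2 is the smallest.\<close>
    case True
    have "opt_time_le n (P n) {} (0 + real (card V) * (real d * (2 * real n / real 2)))"
      by (rule opt_time_le_embed[OF mono assms(1) _ assms(2) _ order_refl fin]) (use n True in auto)
    then show ?thesis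
      using True by (simp add: opt_time_le_def C_def)
  next
    case False
    define y where "y = (real n / 2) powr (1 / real d)"
    define q where "q = nat \<lfloor>y\<rfloor>"
    have "2 * 2 ^ d \<le> n"
      using n by simp
    then have "real (2 * 2 ^ d) \<le> real n"
      by (rule of_nat_mono)
    then have "(2 ^ d) powr (1 / real d) \<le> y"
      unfolding y_def by (intro powr_mono2) auto
    then have y: "y \<ge> 2"
      using False by (simp add: powr_realpow[symmetric] powr_powr)
    then have q: "q \<ge> 2" "real q \<le> y" "real q \<ge> y / 2"
      unfolding q_def by linarith+
    have "real (q ^ d) \<le> y ^ d"
      using q by (simp add: power_mono)
    also have "\<dots> = real n / 2"
      using False n by (simp add: y_def powr_realpow[symmetric] powr_powr)
    finally have "2 * q ^ d \<le> n"
      by (simp add: field_simps flip: of_nat_power)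
    then have qd: "q ^ d + card V \<le> n"
      using n by simp
    have "2 * real n / real q \<le> 8 * real n powr ((real d - 1) / real d)"
    proof -
      \<comment> \<open>Halving \<open>n\<close> costs at most a factor 2 after taking the
        \<open>d\<close>-th root.\<close>
      have "(1 / 2) powr 1 \<le> (1 / 2 :: real) powr (1 / real d)"
        using False by (intro powr_mono') auto
      then have "real n powr (1 / real d) * (1 / 2) \<le> real n powr (1 / real d) * (1 / 2) powr (1 / real d)"
        by (intro mult_left_mono) auto
      also have "\<dots> = y"
        by (simp add: y_def flip: powr_mult)
      finally have "real n powr (1 / real d) / 4 \<le> real q"
        using q by simp
      then have "2 * real n / real q \<le> 2 * real n / (real n powr (1 / real d) / 4)"
        using n q(1) by (intro divide_left_mono) auto
      also have "\<dots> = 8 * (real n powr 1 / real n powr (1 / real d))"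
        by simp
      also have "real n powr 1 / real n powr (1 / real d) = real n powr (1 - 1 / real d)"
        by (simp only: powr_diff)
      also have "1 - 1 / real d = (real d - 1) / real d"
        using False by (simp add: field_simps)
      finally show ?thesis .
    qed
    then have "real (card V) * (real d * (2 * real n / real q)) \<le> C * real n powr ((real d - 1) / real d)"
      unfolding C_def mult.assoc by (intro mult_left_mono) auto
    moreover have "opt_time_le n (P n) {} (0 + real (card V) * (real d * (2 * real n / real q)))"
      by (rule opt_time_le_embed[OF mono assms(1) q(1) assms(2) qd order_refl fin])
    ultimately show ?thesis
      unfolding opt_time_le_def by (metis add_0 order_trans)
  qed
  then have "\<forall>\<^sub>F n in sequentially. \<forall>m. opt_time n (P n) m {} \<le> C * real n powr ((real d - 1) / real d)"
    using eventually_at_top_linorder by blast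
  then show thesis
    using that[of C] by (simp add: C_def)
qed

section \<open>Translation to multigraphs and the limit in n\<close>

text \<open>Containment depends only on which edges occur, so the multiset may be replaced by its
  support; as all edges lie in \<open>V\<close>, the restriction in \<open>embeds\<close> is
  vacuous.\<close>

lemma builder_multigraph_contains_graph:
  assumes "simple_graph V E"
  shows "builder_multigraph n h \<in> contains_graph V E \<longleftrightarrow>
    (\<exists>f. embeds n E ((\<lambda>(u, v). {u, v}) ` set h) V f)"
proof -
  have "\<forall>e\<in>E. e \<subseteq> V"
    using assms by (simp add: simple_graph_def)
  then have "(\<forall>e\<in>E. e \<subseteq> V \<longrightarrow> f ` e \<in> F) \<longleftrightarrow> (\<forall>e\<in>E. f ` e \<in> F)" for f :: "'a \<Rightarrow> nat" and F
    by blast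
  then show ?thesis
    by (simp add: builder_multigraph_def contains_graph_def embeds_def)
qed

lemma tau_le:
  assumes "valid_strategy n \<sigma>" "p \<le> success_prob P n \<sigma> m"
  shows "tau p P n \<le> enat m"
  unfolding tau_def using assms by (intro Inf_lower) auto

theorem theorem1p11:
  fixes V :: "'a set" and E :: "'a set set" and d :: nat and g :: "nat \<Rightarrow> real"
  assumes "simple_graph V E"
    and "d = degeneracy V E"
    and "filterlim g at_top sequentially"
  shows "whp_tau_le (contains_graph V E) (\<lambda>n. g n * real n powr ((real d - 1) / real d)) \<and>
    (\<exists>\<sigma>. (\<forall>n. valid_strategy n (\<sigma> n)) \<and>
      (\<lambda>n. success_prob (contains_graph V E) n (\<sigma> n)
              (nat \<lfloor>g n * real n powr ((real d - 1) / real d)\<rfloor>)) \<longlonglongrightarrow> 1)"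
proof -
  define P where "P = (\<lambda>n F. \<exists>f. embeds n E F V f)"
  define b where "b = (\<lambda>n. real n powr ((real d - 1) / real d))"
  define M where "M = (\<lambda>n. nat \<lfloor>g n * b n\<rfloor>)"
  let ?Q = "contains_graph V E :: nat multigraph set"
  obtain C where C: "C \<ge> 0" "\<forall>\<^sub>F n in sequentially. \<forall>m. opt_time n (P n) m {} \<le> C * b n"
    using opt_time_contains_graph[OF assms(1,2)] unfolding P_def b_def by blast
  have mono: "mono (P n)" for n
    unfolding P_def by (intro monoI le_boolI) (use embeds_mono in blast)
  \<comment> \<open>One strategy per \<open>n\<close> serves both conclusions. In the degenerate
    cases \<open>n = 0\<close> or \<open>M n = 0\<close> a constant strategy fills the gap.\<close>
  have "\<exists>\<sigma>. valid_strategy n \<sigma> \<and>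
      (n > 0 \<longrightarrow> M n > 0 \<longrightarrow> success_prob ?Q n \<sigma> (M n) \<ge> 1 - opt_time n (P n) (M n) {} / real (M n))" for n
  proof (cases "n > 0 \<and> M n > 0")
    case True
    have "builder_multigraph n h \<in> ?Q \<longleftrightarrow> P n ((\<lambda>(u, v). {u, v}) ` set h)" for h
      using builder_multigraph_contains_graph[OF assms(1)] by (simp add: P_def)
    with True success_prob_opt_time[of n "M n" "P n" ?Q] mono show ?thesis
      by metis
  next
    case False
    have "valid_strategy n (\<lambda>h v. return_pmf 1)"
      by (auto simp: valid_strategy_def)
    with False show ?thesis
      by blast
  qed
  then obtain \<sigma> where valid: "\<And>n. valid_strategy n (\<sigma> n)"
    and \<sigma>: "\<And>n. n > 0 \<Longrightarrow> M n > 0 \<Longrightarrow>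
      success_prob ?Q n (\<sigma> n) (M n) \<ge> 1 - opt_time n (P n) (M n) {} / real (M n)"
    by metis
  have g: "\<forall>\<^sub>F n in sequentially. g n \<ge> 2"
    using assms(3) by (simp add: filterlim_at_top)
  have lower: "\<forall>\<^sub>F n in sequentially. 1 - 2 * C / g n \<le> success_prob ?Q n (\<sigma> n) (M n)"
    using C(2) g eventually_gt_at_top[of 0]
  proof eventually_elim
    case (elim n)
    have "b n \<ge> 1"
    \<comment> \<open>For \<open>d = 0\<close> division by zero yields 0, so the exponent is 0 and
      \<open>b n = 1\<close>.\<close>
    proof (cases "d = 0")
      case False
      with elim(3) show ?thesis
        unfolding b_def by (intro ge_one_powr_ge_zero) auto
    qed (use elim(3) in \<open>simp add: b_def\<close>)
    \<comment> \<open>A real number that is at least 2 loses at most half of itself when rounded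
      down.\<close>
    with elim(2) have "g n * b n \<ge> 2 * 1"
      by (intro mult_mono) auto
    then have M: "real (M n) \<ge> g n * b n / 2" "M n > 0"
      unfolding M_def by linarith+
    have "opt_time n (P n) (M n) {} / real (M n) \<le> C * b n / real (M n)"
      using elim(1) by (intro divide_right_mono) auto
    also have "\<dots> \<le> C * b n / (g n * b n / 2)"
      using M C(1) \<open>b n \<ge> 1\<close> elim(2) by (intro divide_left_mono) auto
    also have "\<dots> = 2 * C / g n"
      using \<open>b n \<ge> 1\<close> by (simp add: field_simps)
    finally show ?case
      using \<sigma>[OF elim(3) M(2)] by simp
  qed
  have lim: "(\<lambda>n. success_prob ?Q n (\<sigma> n) (M n)) \<longlonglongrightarrow> 1"
  proof (rule tendsto_sandwich[OF lower])
    show "\<forall>\<^sub>F n in sequentially. success_prob ?Q n (\<sigma> n) (M n) \<le> 1"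
      by (simp add: success_prob_def)
    have "(\<lambda>n. 2 * C / g n) \<longlonglongrightarrow> 0"
      using assms(3) by (intro real_tendsto_divide_at_top[OF tendsto_const])
    then show "(\<lambda>n. 1 - 2 * C / g n) \<longlonglongrightarrow> 1"
      using tendsto_diff[OF tendsto_const, of _ 0 _ 1] by simp
  qed auto
  have "whp_tau_le ?Q (\<lambda>n. g n * b n)"
    unfolding whp_tau_le_def
  proof (intro exI conjI)
    \<comment> \<open>Taking \<epsilon> to be the failure probability of the chosen strategy makes
      the required probability exactly the one attained, so \<open>M n\<close> bounds
      \<open>tau\<close>.\<close>
    show "(\<lambda>n. 1 - success_prob ?Q n (\<sigma> n) (M n)) \<longlonglongrightarrow> 0"
      using tendsto_diff[OF tendsto_const lim, of 1] by simp
    show "\<forall>\<^sub>F n in sequentially.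
        ereal_of_enat (tau (1 - (1 - success_prob ?Q n (\<sigma> n) (M n))) ?Q n) \<le> ereal (g n * b n)"
      using g
    proof eventually_elim
      case (elim n)
      have "ereal_of_enat (tau (1 - (1 - success_prob ?Q n (\<sigma> n) (M n))) ?Q n)
          \<le> ereal_of_enat (enat (M n))"
        by (intro ereal_of_enat_le_iff[THEN iffD2] tau_le[OF valid]) simp
      also have "\<dots> \<le> ereal (g n * b n)"
        using elim by (simp add: M_def b_def)
      finally show ?case .
    qed
  qed
  with valid lim show ?thesis
    unfolding M_def b_def by blast
qed

end
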